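(* Let $\mathbf{M}=(M,+,\wedge,\vee,0)$ be a lattice-ordered monoid. Then there exist an abelian $\ell$-group $\mathbf{K}(\mathbf{M})$ and an $\ell$-monoid homomorphism $h:\mathbf{M}\to\mathbf{K}(\mathbf{M})$ (i.e. a map preserving $+$, $0$, $\wedge$ and $\vee$) such that $h$ is injective if and only if $\mathbf{M}$ is cancellative (i.e. $x+z=y+z$ implies $x=y$ for all $x,y,z\in M$).
   Context: A lattice-ordered monoid ($\ell$-monoid) is a structure $\mathbf{M}=(M,+,\wedge,\vee,0)$ such that $(M,+,0)$ is a commutative monoid, $(M,\wedge,\vee)$ is a lattice, and for all $x,y,z\in M$: $x+(y\wedge z)=(x+y)\wedge(x+z)$ and $x+(y\vee z)=(x+y)\vee(x+z)$. *)

theory Defs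
  imports "HOL-Algebra.Group"
begin

(* The monoid part is the one of HOL-Algebra, so the addition + and the neutral element 0 of the
   mathematical text are written \<otimes> and \<one>. *)

record 'a lat_monoid = "'a monoid" +
  lmeet :: "'a \<Rightarrow> 'a \<Rightarrow> 'a" (infixl "\<curlywedge>\<index>" 70)
  ljoin :: "'a \<Rightarrow> 'a \<Rightarrow> 'a" (infixl "\<curlyvee>\<index>" 65)

(* Lattices as algebras with two operations; the lattice of HOL-Algebra is given by an order
   in a gorder record, which cannot be merged with a monoid record. *)

locale algebraic_lattice =
  fixes L :: "('a, 'b) lat_monoid_scheme" (structure)
  assumes meet_closed [intro, simp]:
      "\<lbrakk>x \<in> carrier L; y \<in> carrier L\<rbrakk> \<Longrightarrow> x \<curlywedge> y \<in> carrier L"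
    and join_closed [intro, simp]:
      "\<lbrakk>x \<in> carrier L; y \<in> carrier L\<rbrakk> \<Longrightarrow> x \<curlyvee> y \<in> carrier L"
    and meet_comm: "\<lbrakk>x \<in> carrier L; y \<in> carrier L\<rbrakk> \<Longrightarrow> x \<curlywedge> y = y \<curlywedge> x"
    and join_comm: "\<lbrakk>x \<in> carrier L; y \<in> carrier L\<rbrakk> \<Longrightarrow> x \<curlyvee> y = y \<curlyvee> x"
    and meet_assoc:
      "\<lbrakk>x \<in> carrier L; y \<in> carrier L; z \<in> carrier L\<rbrakk> \<Longrightarrow> (x \<curlywedge> y) \<curlywedge> z = x \<curlywedge> (y \<curlywedge> z)"
    and join_assoc:
      "\<lbrakk>x \<in> carrier L; y \<in> carrier L; z \<in> carrier L\<rbrakk> \<Longrightarrow> (x \<curlyvee> y) \<curlyvee> z = x \<curlyvee> (y \<curlyvee> z)"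
    and meet_join_absorb: "\<lbrakk>x \<in> carrier L; y \<in> carrier L\<rbrakk> \<Longrightarrow> x \<curlywedge> (x \<curlyvee> y) = x"
    and join_meet_absorb: "\<lbrakk>x \<in> carrier L; y \<in> carrier L\<rbrakk> \<Longrightarrow> x \<curlyvee> (x \<curlywedge> y) = x"

locale l_monoid = comm_monoid M + algebraic_lattice M
  for M :: "('a, 'b) lat_monoid_scheme" (structure) +
  assumes mult_meet_distrib:
      "\<lbrakk>x \<in> carrier M; y \<in> carrier M; z \<in> carrier M\<rbrakk>
        \<Longrightarrow> x \<otimes> (y \<curlywedge> z) = (x \<otimes> y) \<curlywedge> (x \<otimes> z)"
    and mult_join_distrib:
      "\<lbrakk>x \<in> carrier M; y \<in> carrier M; z \<in> carrier M\<rbrakk>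
        \<Longrightarrow> x \<otimes> (y \<curlyvee> z) = (x \<otimes> y) \<curlyvee> (x \<otimes> z)"

locale abelian_l_group = l_monoid G + comm_group G
  for G :: "('a, 'b) lat_monoid_scheme" (structure)

definition l_monoid_hom ::
  "('a, 'c) lat_monoid_scheme \<Rightarrow> ('b, 'd) lat_monoid_scheme \<Rightarrow> ('a \<Rightarrow> 'b) set" where
  "l_monoid_hom M N = {h \<in> hom M N. h \<one>\<^bsub>M\<^esub> = \<one>\<^bsub>N\<^esub> \<and>
     (\<forall>x \<in> carrier M. \<forall>y \<in> carrier M.
        h (x \<curlywedge>\<^bsub>M\<^esub> y) = h x \<curlywedge>\<^bsub>N\<^esub> h y \<and> h (x \<curlyvee>\<^bsub>M\<^esub> y) = h x \<curlyvee>\<^bsub>N\<^esub> h y)}"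

definition cancellative :: "('a, 'b) monoid_scheme \<Rightarrow> bool" where
  "cancellative M \<longleftrightarrow> (\<forall>x \<in> carrier M. \<forall>y \<in> carrier M. \<forall>z \<in> carrier M.
     x \<otimes>\<^bsub>M\<^esub> z = y \<otimes>\<^bsub>M\<^esub> z \<longrightarrow> x = y)"

end

(* K(M) is the group of differences of M: the pair (a, b) stands for a - b, and (a, b), (c, d) are
   identified when a + d + k = c + b + k for some k. Finitely many differences have a common
   subtrahend, and on differences with a common subtrahend the lattice operations act on the
   minuends alone, so the axioms of K(M) reduce to those of M. The map h a = a - 0 identifies x
   and y exactly when x + k = y + k for some k. *)

theory Submission
  imports Defs
begin

section \<open>Differences in a commutative monoid\<close>

context comm_monoid
begin

text \<open>The slack \<open>k\<close> stands in for cancellation: without it the relation need not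
  be transitive.\<close>

definition diff_rel :: "('a \<times> 'a) rel" where
  "diff_rel = {((a, b), (c, d)). a \<in> carrier G \<and> b \<in> carrier G \<and> c \<in> carrier G \<and> d \<in> carrier G
     \<and> (\<exists>k \<in> carrier G. a \<otimes> d \<otimes> k = c \<otimes> b \<otimes> k)}"

definition diff :: "'a \<Rightarrow> 'a \<Rightarrow> ('a \<times> 'a) set" where
  "diff a b = diff_rel `` {(a, b)}"

definition diffs :: "('a \<times> 'a) set set" where
  "diffs = (carrier G \<times> carrier G) // diff_rel"

text \<open>The union runs over all representatives. Once the operation is known to respect
  \<open>diff_rel\<close>, all members of the union are the same class, so no representative has to
  be chosen.\<close>

definition diff_mult :: "('a \<times> 'a) set \<Rightarrow> ('a \<times> 'a) set \<Rightarrow> ('a \<times> 'a) set" where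
  "diff_mult X Y = (\<Union>u \<in> X. \<Union>v \<in> Y. diff (fst u \<otimes> fst v) (snd u \<otimes> snd v))"

text \<open>To combine a - b and c - d, both are rewritten over the subtrahend b + d, with minuends
  a + d and c + b, and \<open>f\<close> acts on these minuends. Meet and join are both obtained this
  way.\<close>

definition diff_lift :: "('a \<Rightarrow> 'a \<Rightarrow> 'a) \<Rightarrow> ('a \<times> 'a) set \<Rightarrow> ('a \<times> 'a) set \<Rightarrow> ('a \<times> 'a) set" where
  "diff_lift f X Y = (\<Union>u \<in> X. \<Union>v \<in> Y. diff (f (fst u \<otimes> snd v) (fst v \<otimes> snd u)) (snd u \<otimes> snd v))"

lemma equiv_diff_rel: "equiv (carrier G \<times> carrier G) diff_rel"
proof (rule equivI)
  show "diff_rel \<subseteq> (carrier G \<times> carrier G) \<times> (carrier G \<times> carrier G)"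
    by (auto simp: diff_rel_def)
  show "refl_on (carrier G \<times> carrier G) diff_rel"
    by (auto simp: refl_on_def diff_rel_def)
  show "sym diff_rel"
    unfolding sym_def diff_rel_def by clarsimp (metis (full_types))
  show "trans diff_rel"
  proof (rule transI, clarify)
    fix a b c d e f
    assume "((a, b), (c, d)) \<in> diff_rel" and "((c, d), (e, f)) \<in> diff_rel"
    then obtain k l where carr: "a \<in> carrier G" "b \<in> carrier G" "c \<in> carrier G" "d \<in> carrier G"
        "e \<in> carrier G" "f \<in> carrier G" "k \<in> carrier G" "l \<in> carrier G"
      and k: "a \<otimes> d \<otimes> k = c \<otimes> b \<otimes> k" and l: "c \<otimes> f \<otimes> l = e \<otimes> d \<otimes> l"
      by (auto simp: diff_rel_def)
    \<comment> \<open>Chaining the two equations leaves the middle subtrahend \<open>d\<close> on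
      both sides. As it cannot be cancelled, it joins \<open>k\<close> and \<open>l\<close> in the
      slack.\<close>
    have "a \<otimes> f \<otimes> (d \<otimes> k \<otimes> l) = (a \<otimes> d \<otimes> k) \<otimes> (f \<otimes> l)"
      using carr by (simp add: m_ac)
    also have "\<dots> = (c \<otimes> f \<otimes> l) \<otimes> (b \<otimes> k)"
      using carr by (simp only: k) (simp add: m_ac)
    also have "\<dots> = e \<otimes> b \<otimes> (d \<otimes> k \<otimes> l)"
      using carr by (simp only: l) (simp add: m_ac)
    finally show "((a, b), (e, f)) \<in> diff_rel"
      using carr by (auto simp: diff_rel_def)
  qed
qed

lemma diff_eq_iff:
  assumes "a \<in> carrier G" "b \<in> carrier G" "c \<in> carrier G" "d \<in> carrier G"
  shows "diff a b = diff c d \<longleftrightarrow> (\<exists>k \<in> carrier G. a \<otimes> d \<otimes> k = c \<otimes> b \<otimes> k)"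
  using eq_equiv_class_iff[OF equiv_diff_rel, of "(a, b)" "(c, d)"] assms
  by (simp add: diff_def diff_rel_def)

lemma diff_eqI:
  assumes "a \<in> carrier G" "b \<in> carrier G" "c \<in> carrier G" "d \<in> carrier G"
    and "a \<otimes> d = c \<otimes> b"
  shows "diff a b = diff c d"
  using assms by (auto simp: diff_eq_iff)

lemma diff_closed [intro, simp]:
  "\<lbrakk>a \<in> carrier G; b \<in> carrier G\<rbrakk> \<Longrightarrow> diff a b \<in> diffs"
  by (auto simp: diffs_def diff_def intro: quotientI)

lemma diffsE:
  assumes "X \<in> diffs"
  obtains a b where "a \<in> carrier G" "b \<in> carrier G" "X = diff a b"
  using assms by (auto simp: diffs_def diff_def elim!: quotientE)

text \<open>Adding the same element to minuend and subtrahend does not change a difference, so each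
  of the three is expanded by the subtrahends of the other two.\<close>

lemma common_diff3E:
  assumes "X \<in> diffs" "Y \<in> diffs" "Z \<in> diffs"
  obtains a b c p where "a \<in> carrier G" "b \<in> carrier G" "c \<in> carrier G" "p \<in> carrier G"
    "X = diff a p" "Y = diff b p" "Z = diff c p"
proof -
  obtain a p b q c r where carr: "a \<in> carrier G" "p \<in> carrier G" "b \<in> carrier G" "q \<in> carrier G"
      "c \<in> carrier G" "r \<in> carrier G"
    and eq: "X = diff a p" "Y = diff b q" "Z = diff c r"
    using assms by (elim diffsE)
  have "X = diff (a \<otimes> q \<otimes> r) (p \<otimes> q \<otimes> r)" "Y = diff (b \<otimes> p \<otimes> r) (p \<otimes> q \<otimes> r)"
    "Z = diff (c \<otimes> p \<otimes> q) (p \<otimes> q \<otimes> r)"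
    unfolding eq using carr by (intro diff_eqI; simp add: m_ac)+
  then show thesis
    using carr by (intro that) auto
qed

lemma common_diff2E:
  assumes "X \<in> diffs" "Y \<in> diffs"
  obtains a b p where "a \<in> carrier G" "b \<in> carrier G" "p \<in> carrier G" "X = diff a p" "Y = diff b p"
  by (rule common_diff3E[OF assms assms(2)]) (rule that)

text \<open>The sum of pairs respects \<open>diff_rel\<close>: by commutativity it is enough to vary
  one argument, and the slack of that argument also serves for the sums.\<close>

lemma diff_mult_diff:
  assumes "a \<in> carrier G" "b \<in> carrier G" "c \<in> carrier G" "d \<in> carrier G"
  shows "diff_mult (diff a b) (diff c d) = diff (a \<otimes> c) (b \<otimes> d)"
proof -
  have "congruent2 diff_rel diff_rel (\<lambda>u v. diff (fst u \<otimes> fst v) (snd u \<otimes> snd v))"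
  proof (rule congruent2_commuteI[OF equiv_diff_rel])
    fix u v w
    assume w: "w \<in> carrier G \<times> carrier G" and uv: "(u, v) \<in> diff_rel"
    obtain a b c d e f where [simp]: "u = (a, b)" "v = (c, d)" "w = (e, f)"
      by (metis surj_pair)
    obtain k where carr: "a \<in> carrier G" "b \<in> carrier G" "c \<in> carrier G" "d \<in> carrier G"
        "e \<in> carrier G" "f \<in> carrier G" "k \<in> carrier G"
      and k: "a \<otimes> d \<otimes> k = c \<otimes> b \<otimes> k"
      using uv w by (auto simp: diff_rel_def)
    have "e \<otimes> a \<otimes> (f \<otimes> d) \<otimes> k = (a \<otimes> d \<otimes> k) \<otimes> (e \<otimes> f)"
      using carr by (simp add: m_ac)
    also have "\<dots> = e \<otimes> c \<otimes> (f \<otimes> b) \<otimes> k"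
      using carr by (simp only: k) (simp add: m_ac)
    finally show "diff (fst w \<otimes> fst u) (snd w \<otimes> snd u) = diff (fst w \<otimes> fst v) (snd w \<otimes> snd v)"
      using carr by (auto simp: diff_eq_iff)
  qed (auto simp: m_comm)
  from UN_equiv_class2[OF equiv_diff_rel equiv_diff_rel this, of "(a, b)" "(c, d)"] assms
  show ?thesis
    by (simp add: diff_mult_def diff_def)
qed

text \<open>Well-definedness rests on distributivity, which lets a summand pass into
  \<open>f\<close>; commutativity of \<open>f\<close> reduces the check to one argument. The case of
  equal subtrahends suffices because differences can always be brought to this form.\<close>

lemma diff_lift_diff:
  assumes closed: "\<And>x y. \<lbrakk>x \<in> carrier G; y \<in> carrier G\<rbrakk> \<Longrightarrow> f x y \<in> carrier G"
    and comm: "\<And>x y. \<lbrakk>x \<in> carrier G; y \<in> carrier G\<rbrakk> \<Longrightarrow> f x y = f y x"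
    and distrib: "\<And>x y z. \<lbrakk>x \<in> carrier G; y \<in> carrier G; z \<in> carrier G\<rbrakk>
      \<Longrightarrow> x \<otimes> f y z = f (x \<otimes> y) (x \<otimes> z)"
    and carr: "a \<in> carrier G" "b \<in> carrier G" "p \<in> carrier G"
  shows "diff_lift f (diff a p) (diff b p) = diff (f a b) p"
proof -
  have "congruent2 diff_rel diff_rel
    (\<lambda>u v. diff (f (fst u \<otimes> snd v) (fst v \<otimes> snd u)) (snd u \<otimes> snd v))"
  proof (rule congruent2_commuteI[OF equiv_diff_rel])
    fix u v w
    assume w: "w \<in> carrier G \<times> carrier G" and uv: "(u, v) \<in> diff_rel"
    obtain a b c d s t where [simp]: "u = (a, b)" "v = (c, d)" "w = (s, t)"
      by (metis surj_pair)
    obtain k where carr: "a \<in> carrier G" "b \<in> carrier G" "c \<in> carrier G" "d \<in> carrier G"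
        "s \<in> carrier G" "t \<in> carrier G" "k \<in> carrier G"
      and k: "a \<otimes> d \<otimes> k = c \<otimes> b \<otimes> k"
      using uv w by (auto simp: diff_rel_def)
    \<comment> \<open>The two values of \<open>f\<close> to be compared carry different outer
      summands. Moved inside, these make the arguments agree one by one: one pair by
      \<open>k\<close>, the other by mere rearrangement.\<close>
    have distrib_right: "f x y \<otimes> z \<otimes> k = f (z \<otimes> k \<otimes> x) (z \<otimes> k \<otimes> y)"
      if "x \<in> carrier G" "y \<in> carrier G" "z \<in> carrier G" for x y z
      using that carr distrib[of "z \<otimes> k" x y] by (metis closed m_closed m_assoc m_comm)
    have "t \<otimes> d \<otimes> k \<otimes> (a \<otimes> t) = (a \<otimes> d \<otimes> k) \<otimes> (t \<otimes> t)"
      using carr by (simp add: m_ac)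
    also have "\<dots> = t \<otimes> b \<otimes> k \<otimes> (c \<otimes> t)"
      using carr by (simp only: k) (simp add: m_ac)
    finally have 1: "t \<otimes> d \<otimes> k \<otimes> (a \<otimes> t) = t \<otimes> b \<otimes> k \<otimes> (c \<otimes> t)" .
    have 2: "t \<otimes> d \<otimes> k \<otimes> (s \<otimes> b) = t \<otimes> b \<otimes> k \<otimes> (s \<otimes> d)"
      using carr by (simp add: m_ac)
    have "f (s \<otimes> b) (a \<otimes> t) \<otimes> (t \<otimes> d) \<otimes> k = f (s \<otimes> d) (c \<otimes> t) \<otimes> (t \<otimes> b) \<otimes> k"
      using carr by (simp add: distrib_right 1 2)
    then show "diff (f (fst w \<otimes> snd u) (fst u \<otimes> snd w)) (snd w \<otimes> snd u) =
        diff (f (fst w \<otimes> snd v) (fst v \<otimes> snd w)) (snd w \<otimes> snd v)"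
      using carr by (auto simp: diff_eq_iff closed)
  qed (auto simp: m_comm comm)
  \<comment> \<open>The definition of \<open>diff_lift\<close> yields the subtrahend
    \<open>p \<otimes> p\<close> here. The surplus \<open>p\<close> is pulled out of
    \<open>f\<close> by distributivity and then removed from the difference.\<close>
  from UN_equiv_class2[OF equiv_diff_rel equiv_diff_rel this, of "(a, p)" "(b, p)"] carr
  have "diff_lift f (diff a p) (diff b p) = diff (f (a \<otimes> p) (b \<otimes> p)) (p \<otimes> p)"
    by (simp add: diff_lift_def diff_def)
  also have "f (a \<otimes> p) (b \<otimes> p) = p \<otimes> f a b"
    using carr by (simp add: distrib m_comm)
  also have "diff (p \<otimes> f a b) (p \<otimes> p) = diff (f a b) p"
    using carr by (intro diff_eqI) (simp_all add: closed m_ac)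
  finally show ?thesis .
qed

end

section \<open>The abelian l-group of differences and the canonical map\<close>

context l_monoid
begin

definition diff_group :: "('a \<times> 'a) set lat_monoid" where
  "diff_group = \<lparr>carrier = diffs, mult = diff_mult, one = diff \<one> \<one>,
     lmeet = diff_lift (lmeet M), ljoin = diff_lift (ljoin M)\<rparr>"

lemma diff_meet_diff:
  "\<lbrakk>a \<in> carrier M; b \<in> carrier M; p \<in> carrier M\<rbrakk>
    \<Longrightarrow> diff_lift (lmeet M) (diff a p) (diff b p) = diff (a \<curlywedge> b) p"
  by (intro diff_lift_diff) (auto simp: mult_meet_distrib intro: meet_comm)

lemma diff_join_diff:
  "\<lbrakk>a \<in> carrier M; b \<in> carrier M; p \<in> carrier M\<rbrakk>
    \<Longrightarrow> diff_lift (ljoin M) (diff a p) (diff b p) = diff (a \<curlyvee> b) p"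
  by (intro diff_lift_diff) (auto simp: mult_join_distrib intro: join_comm)

lemmas diff_ops = diff_mult_diff diff_meet_diff diff_join_diff

text \<open>All laws but the existence of inverses carry over from the monoid through
  representatives; the inverse of a - b is b - a.\<close>

lemma comm_group_diff_group: "comm_group diff_group"
proof (rule comm_groupI)
  fix X assume "X \<in> carrier diff_group"
  then have "X \<in> diffs"
    by (simp add: diff_group_def)
  then obtain a b where ab: "a \<in> carrier M" "b \<in> carrier M" "X = diff a b"
    by (rule diffsE)
  have "diff (b \<otimes> a) (a \<otimes> b) = diff \<one> \<one>"
    using ab by (intro diff_eqI) (simp_all add: m_comm)
  with ab have "diff_mult (diff b a) X = diff \<one> \<one>"
    by (simp add: diff_ops)
  with ab show "\<exists>Y \<in> carrier diff_group. Y \<otimes>\<^bsub>diff_group\<^esub> X = \<one>\<^bsub>diff_group\<^esub>"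
    by (auto simp: diff_group_def)
qed (auto simp: diff_group_def diff_ops m_ac elim!: diffsE)

text \<open>A lattice axiom involves at most three elements. Over a common subtrahend
  \<open>p\<close> it becomes the same axiom for the minuends.\<close>

lemma algebraic_lattice_diff_group: "algebraic_lattice diff_group"
proof
  fix X Y assume "X \<in> carrier diff_group" "Y \<in> carrier diff_group"
  then have "X \<in> diffs" "Y \<in> diffs"
    by (auto simp: diff_group_def)
  then obtain a b p where *: "a \<in> carrier M" "b \<in> carrier M" "p \<in> carrier M"
      "X = diff a p" "Y = diff b p"
    by (rule common_diff2E)
  show "X \<curlywedge>\<^bsub>diff_group\<^esub> Y \<in> carrier diff_group" "X \<curlyvee>\<^bsub>diff_group\<^esub> Y \<in> carrier diff_group"
    using * by (auto simp: diff_group_def diff_ops)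
  show "X \<curlywedge>\<^bsub>diff_group\<^esub> Y = Y \<curlywedge>\<^bsub>diff_group\<^esub> X" "X \<curlyvee>\<^bsub>diff_group\<^esub> Y = Y \<curlyvee>\<^bsub>diff_group\<^esub> X"
    using * by (simp_all add: diff_group_def diff_ops meet_comm join_comm)
  show "X \<curlywedge>\<^bsub>diff_group\<^esub> (X \<curlyvee>\<^bsub>diff_group\<^esub> Y) = X" "X \<curlyvee>\<^bsub>diff_group\<^esub> (X \<curlywedge>\<^bsub>diff_group\<^esub> Y) = X"
    using * by (simp_all add: diff_group_def diff_ops meet_join_absorb join_meet_absorb)
next
  fix X Y Z
  assume "X \<in> carrier diff_group" "Y \<in> carrier diff_group" "Z \<in> carrier diff_group"
  then have "X \<in> diffs" "Y \<in> diffs" "Z \<in> diffs"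
    by (auto simp: diff_group_def)
  then obtain a b c p where *: "a \<in> carrier M" "b \<in> carrier M" "c \<in> carrier M" "p \<in> carrier M"
      "X = diff a p" "Y = diff b p" "Z = diff c p"
    by (rule common_diff3E)
  show "X \<curlywedge>\<^bsub>diff_group\<^esub> Y \<curlywedge>\<^bsub>diff_group\<^esub> Z = X \<curlywedge>\<^bsub>diff_group\<^esub> (Y \<curlywedge>\<^bsub>diff_group\<^esub> Z)"
    "X \<curlyvee>\<^bsub>diff_group\<^esub> Y \<curlyvee>\<^bsub>diff_group\<^esub> Z = X \<curlyvee>\<^bsub>diff_group\<^esub> (Y \<curlyvee>\<^bsub>diff_group\<^esub> Z)"
    using * by (simp_all add: diff_group_def diff_ops meet_assoc join_assoc)
qed

text \<open>With \<open>X\<close>, \<open>Y\<close>, \<open>Z\<close> over \<open>p\<close>, the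
  sums of \<open>X\<close> with \<open>Y\<close> and with \<open>Z\<close> share the subtrahend
  \<open>p \<otimes> p\<close>, so both sides of each law are differences over it and distributivity
  in \<open>M\<close> makes the minuends equal.\<close>

lemma abelian_l_group_diff_group: "abelian_l_group diff_group"
proof -
  interpret K: comm_group diff_group
    by (rule comm_group_diff_group)
  interpret K: algebraic_lattice diff_group
    by (rule algebraic_lattice_diff_group)
  show ?thesis
  proof
    fix X Y Z
    assume "X \<in> carrier diff_group" "Y \<in> carrier diff_group" "Z \<in> carrier diff_group"
    then have "X \<in> diffs" "Y \<in> diffs" "Z \<in> diffs"
      by (auto simp: diff_group_def)
    then obtain a b c p where "a \<in> carrier M" "b \<in> carrier M" "c \<in> carrier M" "p \<in> carrier M"
      "X = diff a p" "Y = diff b p" "Z = diff c p"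
      by (rule common_diff3E)
    then show "X \<otimes>\<^bsub>diff_group\<^esub> (Y \<curlywedge>\<^bsub>diff_group\<^esub> Z) =
        X \<otimes>\<^bsub>diff_group\<^esub> Y \<curlywedge>\<^bsub>diff_group\<^esub> (X \<otimes>\<^bsub>diff_group\<^esub> Z)"
      "X \<otimes>\<^bsub>diff_group\<^esub> (Y \<curlyvee>\<^bsub>diff_group\<^esub> Z) =
        X \<otimes>\<^bsub>diff_group\<^esub> Y \<curlyvee>\<^bsub>diff_group\<^esub> (X \<otimes>\<^bsub>diff_group\<^esub> Z)"
      by (simp_all add: diff_group_def diff_ops mult_meet_distrib mult_join_distrib)
  qed
qed

text \<open>All images have the subtrahend \<open>\<one>\<close>, so meets and joins act on the
  minuends at once; for sums, \<open>\<one> \<otimes> \<one>\<close> is again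
  \<open>\<one>\<close>.\<close>

lemma diff_one_l_monoid_hom: "(\<lambda>a. diff a \<one>) \<in> l_monoid_hom M diff_group"
  by (auto simp: l_monoid_hom_def hom_def diff_group_def diff_ops)

lemma inj_on_diff_one_iff: "inj_on (\<lambda>a. diff a \<one>) (carrier M) \<longleftrightarrow> cancellative M"
  by (auto simp: inj_on_def cancellative_def diff_eq_iff)

end

theorem theorem3p1:
  fixes M :: "('a, 'b) lat_monoid_scheme"
  assumes "l_monoid M"
  shows "\<exists>(K :: ('a \<times> 'a) set lat_monoid) (h :: 'a \<Rightarrow> ('a \<times> 'a) set).
           abelian_l_group K \<and> h \<in> l_monoid_hom M K \<and>
           (inj_on h (carrier M) \<longleftrightarrow> cancellative M)"
proof -
  interpret l_monoid M
    by fact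
  show ?thesis
    using abelian_l_group_diff_group diff_one_l_monoid_hom inj_on_diff_one_iff by blast
qed

end
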